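(* Let $X$ be a compact metric space and $\tau:X\to X$ a uniquely ergodic continuous transformation with $\tau$-invariant Borel probability measure $\nu$. Let $Y\subseteq{}^*X$ be a hyperfinite set such that $\mathrm{st}(Y)=X$, and let $T:Y\to Y$ be an internal permutation such that $\mathrm{st}(T(y))=\tau(\mathrm{st}(y))$ for all $y\in Y$. Then for every $y\in Y$ such that the $\tau$-orbit of $\mathrm{st}(y)$ is dense in $X$, for every infinite $N\in{}^*\mathbb{N}$ and for every $f\in C(X)$ one has $$A_N({}^*f\upharpoonright Y,T,y)\approx\int_X f\,d\nu .$$
   Context: We work in an $\aleph_1$-saturated nonstandard universe; $\approx$ means infinitely close. $\mathrm{st}:{}^*X\to X$ is the standard part map of the compact metric space $X$. A continuous transformation $\tau:X\to X$ is uniquely ergodic if there is exactly one $\tau$-invariant Borel probability measure on $X$. For an internal $F:Y\to{}^*\mathbb{R}$ and $k\in{}^*\mathbb{N}$, $k\ge1$, $A_k(F,T,y)=\frac1k\sum_{i=0}^{k-1}F(T^iy)$. *)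

theory Defs
  imports "HOL-Probability.Probability_Measure"
begin

text \<open>
  A nonstandard universe is given here by its part above one set \<open>U\<close> of standard entities,
  the type \<open>'u\<close>: a set \<open>*U\<close>, the type \<open>'w\<close>, together with the maps
  \<open>a \<mapsto> *a\<close> (\<open>emb\<close>) and \<open>R \<mapsto> *R\<close> (\<open>rel\<close>), the latter defined for all
  finitary relations \<open>R\<close> on \<open>U\<close>; tuples are lists. The transfer principle is required
  for all first-order formulas over \<open>U\<close> in which every relation on \<open>U\<close> may occur. In a
  superstructure these are bounded formulas, so if \<open>*\<close> is any nonstandard
  superstructure embedding and \<open>U\<close> is a set in the standard superstructure, then its
  restriction to \<open>U\<close> and the relations on \<open>U\<close> is a nonstandard universe in the present
  sense. No particular construction (such as an ultrapower) is assumed.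
\<close>

datatype 'u formula =
    Eq nat nat
  | Atom "'u list set" "nat list"
  | Neg "'u formula"
  | Conj "'u formula" "'u formula"
  | Exi nat "'u formula"

primrec sat :: "('u list set \<Rightarrow> 'w list set) \<Rightarrow> (nat \<Rightarrow> 'w) \<Rightarrow> 'u formula \<Rightarrow> bool" where
  "sat I e (Eq i j) \<longleftrightarrow> e i = e j"
| "sat I e (Atom R vs) \<longleftrightarrow> map e vs \<in> I R"
| "sat I e (Neg \<phi>) \<longleftrightarrow> \<not> sat I e \<phi>"
| "sat I e (Conj \<phi> \<psi>) \<longleftrightarrow> sat I e \<phi> \<and> sat I e \<psi>"
| "sat I e (Exi i \<phi>) \<longleftrightarrow> (\<exists>a. sat I (e(i := a)) \<phi>)"

record ('u, 'w) extension =
  emb :: "'u \<Rightarrow> 'w"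
  rel :: "'u list set \<Rightarrow> 'w list set"

definition transfer_principle :: "('u, 'w) extension \<Rightarrow> bool" where
  "transfer_principle \<U> \<longleftrightarrow>
     (\<forall>\<phi> e. sat (\<lambda>R. R) e \<phi> \<longleftrightarrow> sat (rel \<U>) (emb \<U> \<circ> e) \<phi>)"

text \<open>
  Sections of \<open>*R\<close> at parameters from \<open>*U\<close>. For \<open>U\<close> inside a superstructure all of
  these are internal subsets of \<open>*U\<close>, so saturation of the superstructure implies
  saturation as defined below.
\<close>

definition internal_set :: "('u, 'w) extension \<Rightarrow> 'w set \<Rightarrow> bool" where
  "internal_set \<U> D \<longleftrightarrow> (\<exists>R ps. D = {v. v # ps \<in> rel \<U> R})"

definition aleph1_saturated :: "('u, 'w) extension \<Rightarrow> bool" where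
  "aleph1_saturated \<U> \<longleftrightarrow>
     (\<forall>D :: nat \<Rightarrow> 'w set.
        (\<forall>n. internal_set \<U> (D n)) \<and> (\<forall>n. (\<Inter>i\<le>n. D i) \<noteq> {}) \<longrightarrow> (\<Inter>n. D n) \<noteq> {})"

definition nonstandard_universe :: "('u, 'w) extension \<Rightarrow> bool" where
  "nonstandard_universe \<U> \<longleftrightarrow> transfer_principle \<U> \<and> aleph1_saturated \<U>"

text \<open>
  The standard entities over a space \<open>X\<close> (the type \<open>'a\<close>): points, real numbers, natural
  numbers, subsets of \<open>X\<close>, and functions from subsets of \<open>X\<close> to \<open>X\<close> and to the reals
  (as partial maps, the subset being the domain). An element of \<open>*U\<close> lying in the star of
  one of the last three sorts is an internal set or an internal function, represented by
  a code; \<open>elems\<close> and \<open>apply_map\<close> give the actual set and values.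
\<close>

datatype 'a entity =
    Pt 'a
  | Num real
  | Idx nat
  | PSet "'a set"
  | PMap "'a \<rightharpoonup> 'a"
  | RMap "'a \<rightharpoonup> real"

definition hyperfinite :: "('a entity, 'w) extension \<Rightarrow> 'w \<Rightarrow> bool" where
  "hyperfinite \<U> Y \<longleftrightarrow> [Y] \<in> rel \<U> {[PSet A] | A. finite A}"

definition elems :: "('a entity, 'w) extension \<Rightarrow> 'w \<Rightarrow> 'w set" where
  "elems \<U> Y = {v. [v, Y] \<in> rel \<U> {[Pt p, PSet A] | p A. p \<in> A}}"

definition apply_map :: "('a entity, 'w) extension \<Rightarrow> 'w \<Rightarrow> 'w \<Rightarrow> 'w" where
  "apply_map \<U> T v = (THE w. [T, v, w] \<in> rel \<U> {[PMap m, Pt p, Pt q] | m p q. m p = Some q})"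

definition internal_permutation :: "('a entity, 'w) extension \<Rightarrow> 'w \<Rightarrow> 'w \<Rightarrow> bool" where
  "internal_permutation \<U> Y T \<longleftrightarrow>
     [T, Y] \<in> rel \<U> {[PMap m, PSet (dom m)] | m. True} \<and>
     bij_betw (apply_map \<U> T) (elems \<U> Y) (elems \<U> Y)"

definition infinitely_close :: "('a::metric_space entity, 'w) extension \<Rightarrow> 'w \<Rightarrow> 'w \<Rightarrow> bool" where
  "infinitely_close \<U> v w \<longleftrightarrow>
     (\<forall>\<epsilon>>0. [v, w] \<in> rel \<U> {[Pt p, Pt q] | p q. dist p q < \<epsilon>} \<or>
            [v, w] \<in> rel \<U> {[Num r, Num s] | r s. dist r s < \<epsilon>})"

definition st :: "('a::metric_space entity, 'w) extension \<Rightarrow> 'w \<Rightarrow> 'a" where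
  "st \<U> v = (THE a. infinitely_close \<U> v (emb \<U> (Pt a)))"

definition infinite_hypernatural :: "('a entity, 'w) extension \<Rightarrow> 'w \<Rightarrow> bool" where
  "infinite_hypernatural \<U> N \<longleftrightarrow>
     (\<forall>n. [emb \<U> (Idx n), N] \<in> rel \<U> {[Idx i, Idx j] | i j. i < j})"

text \<open>The internal function \<open>*f\<close> restricted to the internal set \<open>Y\<close>.\<close>

definition star_restrict :: "('a entity, 'w) extension \<Rightarrow> ('a \<Rightarrow> real) \<Rightarrow> 'w \<Rightarrow> 'w" where
  "star_restrict \<U> f Y =
     (THE F. [Y, F] \<in> rel \<U> {[PSet A, RMap ((Some \<circ> f) |` A)] | A. True})"

definition average :: "nat \<Rightarrow> ('a \<rightharpoonup> real) \<Rightarrow> ('a \<rightharpoonup> 'a) \<Rightarrow> 'a \<Rightarrow> real" where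
  "average k g m p = 1 / real k * (\<Sum>i<k. the (g (((\<lambda>q. the (m q)) ^^ i) p)))"

text \<open>The extension of \<open>average\<close> to hypernatural lengths and internal functions.\<close>

definition hyper_average :: "('a entity, 'w) extension \<Rightarrow> 'w \<Rightarrow> 'w \<Rightarrow> 'w \<Rightarrow> 'w \<Rightarrow> 'w" where
  "hyper_average \<U> k F T y =
     (THE r. [k, F, T, y, r] \<in>
        rel \<U> {[Idx n, RMap g, PMap m, Pt p, Num (average n g m p)] | n g m p. True})"

definition invariant_prob :: "('a::metric_space \<Rightarrow> 'a) \<Rightarrow> 'a measure \<Rightarrow> bool" where
  "invariant_prob \<tau> \<mu> \<longleftrightarrow>
     prob_space \<mu> \<and> sets \<mu> = sets borel \<and>
     (\<forall>A \<in> sets borel. measure \<mu> (\<tau> -` A) = measure \<mu> A)"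

definition uniquely_ergodic :: "('a::metric_space \<Rightarrow> 'a) \<Rightarrow> bool" where
  "uniquely_ergodic \<tau> \<longleftrightarrow> (\<exists>!\<mu>. invariant_prob \<tau> \<mu>)"

end

theory Submission
  imports Defs "HOL-Probability.Helly_Selection"
begin

text \<open>
  The proof compares the time averages of infinite length with those of one fixed finite length.
  
  Unique ergodicity makes finite averages uniform: for each \<open>\<epsilon> > 0\<close> there is a single
  standard \<open>m\<close> such that the average of \<open>f\<close> over the first \<open>m\<close> points of every \<open>\<tau>\<close>-orbit is
  within \<open>\<epsilon>\<close> of \<open>\<integral>f d\<nu>\<close> (\<open>uniform_ergodic_averages\<close>). If this failed, the uniform
  measures on a sequence of bad orbit segments of growing length would have a weak limit point.
  This limit is \<open>\<tau>\<close>-invariant, because an average over \<open>n\<close> orbit points changes by at most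
  \<open>2 \<parallel>g\<parallel> / n\<close> when \<open>g\<close> is replaced by \<open>g \<circ> \<tau>\<close>; hence it equals \<open>\<nu>\<close>, but it integrates \<open>f\<close>
  to a value at distance at least \<open>\<epsilon>\<close> from \<open>\<integral>f d\<nu>\<close>. The weak limit point exists by
  compactness (\<open>empirical_measures_subsequence\<close>). It is obtained from Helly's selection theorem
  on the real line: a Cantor-style coding embeds the space in the reals with a uniformly
  continuous inverse, and the limit measure on the reals is decoded back into the space.
  
  For standard \<open>m\<close>, the first \<open>m\<close> points of the \<open>T\<close>-orbit of any \<open>z \<in> Y\<close> stay infinitely close
  to the \<open>\<tau>\<close>-orbit of \<open>st z\<close> (\<open>orbit_shadowing\<close>), so by uniform continuity of \<open>f\<close> the average
  of \<open>*f\<close> of length \<open>m\<close> along \<open>T\<close> is near \<open>\<integral>f d\<nu>\<close>, at every \<open>z \<in> Y\<close>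
  (\<open>block_average_near\<close>). An average of length \<open>n\<close> differs from the mean of the averages of
  length \<open>m\<close> started along the same orbit by at most \<open>2 m \<parallel>f\<parallel> / n\<close>
  (\<open>average_near_if_block_averages_near\<close>). This elementary estimate transfers to internal maps
  and hypernatural lengths (\<open>hyper_average_bound\<close>), where the error is infinitesimal for
  infinite \<open>N\<close>. As \<open>\<epsilon>\<close> was arbitrary, the average of length \<open>N\<close> is infinitely close to the
  integral.
\<close>

section \<open>Averages along a sequence\<close>

lemma abs_sum_shift_le:
  fixes a :: "nat \<Rightarrow> real"
  assumes "\<And>i. \<bar>a i\<bar> \<le> B"
  shows "\<bar>(\<Sum>i<n. a (i + j)) - (\<Sum>i<n. a i)\<bar> \<le> 2 * real j * B"
proof (induction j)
  case (Suc j)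
  have "(\<Sum>i<n. a (i + Suc j)) - (\<Sum>i<n. a (i + j)) = a (n + j) - a j"
    using sum_lessThan_telescope[of "\<lambda>i. a (i + j)" n] by (simp add: sum_subtractf)
  then show ?case
    using Suc assms[of "n + j"] assms[of j] by (simp add: algebra_simps abs_le_iff)
qed simp

text \<open>
  Summing the blocks \<open>a (i + j)\<close> over both \<open>i < n\<close> and \<open>j < m\<close> gives \<open>n\<close> block sums, hence
  about \<open>n m c\<close>; summed the other way it gives \<open>m\<close> shifts of the full sum, each of them off by
  at most \<open>2 m B\<close>. The hypothesis on \<open>n\<close> makes this boundary error no larger than the error
  coming from the blocks.
\<close>

lemma average_near_if_block_averages_near:
  fixes a :: "nat \<Rightarrow> real"
  assumes B: "\<And>i. \<bar>a i\<bar> \<le> B" and "m > 0" "n > 0"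
    and block: "\<And>i. \<bar>(\<Sum>j<m. a (i + j)) / real m - c\<bar> \<le> \<delta>"
    and n: "2 * real m * B \<le> real n * \<delta>"
  shows "\<bar>(\<Sum>i<n. a i) / real n - c\<bar> \<le> 2 * \<delta>"
proof -
  let ?S = "\<Sum>i<n. a i"
  have "B \<ge> 0" using B[of 0] by linarith
  have swap: "(\<Sum>j<m. \<Sum>i<n. a (i + j)) = (\<Sum>i<n. \<Sum>j<m. a (i + j))"
    by (rule sum.swap)
  have "\<bar>(\<Sum>j<m. a (i + j)) - real m * c\<bar> \<le> real m * \<delta>" for i
    using block[of i] \<open>m > 0\<close> by (simp add: abs_le_iff field_simps)
  then have "(\<Sum>i<n. \<bar>(\<Sum>j<m. a (i + j)) - real m * c\<bar>) \<le> (\<Sum>i<n. real m * \<delta>)"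
    by (rule sum_mono)
  then have 1: "\<bar>(\<Sum>i<n. \<Sum>j<m. a (i + j)) - real n * (real m * c)\<bar> \<le> real n * (real m * \<delta>)"
    using sum_abs[of "\<lambda>i. (\<Sum>j<m. a (i + j)) - real m * c" "{..<n}"]
    by (simp add: sum_subtractf)
  have "\<bar>(\<Sum>i<n. a (i + j)) - ?S\<bar> \<le> 2 * real m * B" if "j < m" for j
  proof -
    have "2 * real j * B \<le> 2 * real m * B"
      using that \<open>B \<ge> 0\<close> by (intro mult_mono) auto
    with abs_sum_shift_le[where a = a and B = B and n = n and j = j, OF B] show ?thesis by linarith
  qed
  then have "(\<Sum>j<m. \<bar>(\<Sum>i<n. a (i + j)) - ?S\<bar>) \<le> (\<Sum>j<m. 2 * real m * B)"
    by (intro sum_mono) auto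
  then have 2: "\<bar>(\<Sum>j<m. \<Sum>i<n. a (i + j)) - real m * ?S\<bar> \<le> real m * (2 * real m * B)"
    using sum_abs[of "\<lambda>j. (\<Sum>i<n. a (i + j)) - ?S" "{..<m}"]
    by (simp add: sum_subtractf)
  have "real m * (2 * real m * B) \<le> real m * (real n * \<delta>)"
    using n by (intro mult_left_mono) auto
  then have "\<bar>real m * ?S - real n * (real m * c)\<bar> \<le> real m * (2 * (real n * \<delta>))"
    using 1 2 unfolding swap by (simp add: abs_le_iff algebra_simps)
  also have "real m * ?S - real n * (real m * c) = real m * (?S - real n * c)"
    by (simp add: algebra_simps)
  finally have "\<bar>?S - real n * c\<bar> \<le> 2 * (real n * \<delta>)"
    using \<open>m > 0\<close> by (simp add: abs_mult)
  then show ?thesis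
    using \<open>n > 0\<close> by (simp add: abs_le_iff field_simps)
qed

lemma orbit_in_dom:
  assumes "ran t \<subseteq> dom t" "p \<in> dom t"
  shows "((\<lambda>q. the (t q)) ^^ i) p \<in> dom t"
proof (induction i)
  case (Suc i)
  then obtain q where "t (((\<lambda>q. the (t q)) ^^ i) p) = Some q" by auto
  then show ?case using assms(1) by (auto simp: ran_def)
qed (use assms in simp)

lemma average_restrict:
  assumes "ran t \<subseteq> dom t" "p \<in> dom t"
  shows "average n ((Some \<circ> f) |` dom t) t p = (\<Sum>i<n. f (((\<lambda>q. the (t q)) ^^ i) p)) / real n"
  using orbit_in_dom[OF assms] by (simp add: average_def restrict_map_def)

text \<open>
  The form of the estimate that is transferred later: it speaks of partial maps, since these are
  the standard counterparts of internal functions on \<open>Y\<close>.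
\<close>

lemma average_bound:
  fixes f :: "'a \<Rightarrow> real"
  assumes t: "ran t \<subseteq> dom t" "p \<in> dom t" and f: "\<And>x. \<bar>f x\<bar> \<le> B" and "m > 0" "n > 0"
    and n: "2 * real m * B \<le> real n * \<delta>"
    and block: "\<And>q. q \<in> dom t \<Longrightarrow> \<bar>average m ((Some \<circ> f) |` dom t) t q - c\<bar> \<le> \<delta>"
  shows "\<bar>average n ((Some \<circ> f) |` dom t) t p - c\<bar> \<le> 2 * \<delta>"
proof -
  let ?S = "\<lambda>q. the (t q)"
  have "\<bar>(\<Sum>j<m. f ((?S ^^ (i + j)) p)) / real m - c\<bar> \<le> \<delta>" for i
  proof -
    have "(?S ^^ (i + j)) p = (?S ^^ j) ((?S ^^ i) p)" for j
      by (subst add.commute) (simp add: funpow_add)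
    with block[OF orbit_in_dom[OF t, of i]] show ?thesis
      by (simp add: average_restrict[OF t(1) orbit_in_dom[OF t]])
  qed
  from average_near_if_block_averages_near[of "\<lambda>i. f ((?S ^^ i) p)" B, OF f \<open>m > 0\<close> \<open>n > 0\<close> this n]
  show ?thesis by (simp add: average_restrict[OF t])
qed

section \<open>Weak compactness of empirical measures\<close>

lemma compact_finite_ball_cover:
  fixes r :: "'a::metric_space \<Rightarrow> real"
  assumes "compact (UNIV :: 'a set)" and r: "\<And>a. r a > 0"
  obtains S where "finite S" "\<And>x. \<exists>a\<in>S. dist a x < r a"
proof -
  have cover: "UNIV \<subseteq> (\<Union>a\<in>UNIV. ball a (r a))"
    using r by (auto intro: centre_in_ball[THEN iffD2])
  show thesis
  proof (rule compactE_image[OF assms(1) _ cover])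
    show "open (ball a (r a))" for a by (rule open_ball)
    fix S assume "finite S" and S: "UNIV \<subseteq> (\<Union>a\<in>S. ball a (r a))"
    have "\<exists>a\<in>S. dist a x < r a" for x
    proof -
      have "x \<in> (\<Union>a\<in>S. ball a (r a))" using S by (rule subsetD) simp
      then show ?thesis by auto
    qed
    with \<open>finite S\<close> show thesis by (rule that)
  qed
qed

lemma ternary_tail: "(\<Sum>i. (1/3::real) ^ (i + Suc j)) = (1/3) ^ j / 2"
  using suminf_mult[OF summable_geometric[of "1/3::real"], of "(1/3) ^ Suc j"]
  by (simp add: suminf_geometric power_add mult.commute)

text \<open>
  Base 3 with digits 0 and 1 only: the first differing digit contributes \<open>3\<close> to the power
  \<open>-k\<close>, which all later digits together can only halve. So nearby values share their leading
  digits, the property that base 2 lacks.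
\<close>

lemma ternary_digits_separated:
  fixes a b :: "nat \<Rightarrow> bool"
  assumes less: "\<bar>(\<Sum>i. of_bool (a i) * (1/3::real) ^ i) - (\<Sum>i. of_bool (b i) * (1/3) ^ i)\<bar> < (1/3) ^ J / 2"
    and "j < J"
  shows "a j \<longleftrightarrow> b j"
proof (rule ccontr)
  assume "a j \<noteq> b j"
  define k where "k = (LEAST k. a k \<noteq> b k)"
  have k: "a k \<noteq> b k" and below: "\<And>i. i < k \<Longrightarrow> a i \<longleftrightarrow> b i"
    unfolding k_def using LeastI[of "\<lambda>k. a k \<noteq> b k", OF \<open>a j \<noteq> b j\<close>] not_less_Least by blast+
  have "k \<le> j"
    unfolding k_def using \<open>a j \<noteq> b j\<close> by (rule Least_le)
  let ?d = "\<lambda>i. (of_bool (a i) - of_bool (b i)) * (1/3::real) ^ i"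
  have geo: "summable (\<lambda>i. (1/3::real) ^ i)"
    by (rule summable_geometric) simp
  have sum: "summable (\<lambda>i. of_bool (c i) * (1/3::real) ^ i)" for c
    by (rule summable_comparison_test'[OF geo, of 0]) (simp add: of_bool_def)
  have sum_d: "summable ?d"
    using summable_diff[OF sum[of a] sum[of b]] by (simp add: left_diff_distrib)
  have diff: "(\<Sum>i. of_bool (a i) * (1/3::real) ^ i) - (\<Sum>i. of_bool (b i) * (1/3) ^ i) = (\<Sum>i. ?d i)"
    using suminf_diff[OF sum[of a] sum[of b]] by (simp add: left_diff_distrib)
  also have "\<dots> = (\<Sum>i. ?d (i + Suc k)) + ?d k"
    using suminf_split_initial_segment[OF sum_d, of "Suc k"] below by simp
  finally have eq: "(\<Sum>i. of_bool (a i) * (1/3::real) ^ i) - (\<Sum>i. of_bool (b i) * (1/3) ^ i) =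
      (\<Sum>i. ?d (i + Suc k)) + ?d k" .
  have geo': "summable (\<lambda>i. (1/3::real) ^ (i + Suc k))"
    using geo by (subst summable_iff_shift)
  have le: "norm (?d (i + Suc k)) \<le> (1/3) ^ (i + Suc k)" for i
    by (simp add: of_bool_def abs_mult del: power_Suc)
  have sum_n: "summable (\<lambda>i. norm (?d (i + Suc k)))"
    using summable_comparison_test'[OF geo', of 0 "\<lambda>i. norm (?d (i + Suc k))"] le by simp
  have "norm (\<Sum>i. ?d (i + Suc k)) \<le> (\<Sum>i. norm (?d (i + Suc k)))"
    by (rule summable_norm[OF sum_n])
  also have "\<dots> \<le> (1/3) ^ k / 2"
    using suminf_le[OF le sum_n geo'] by (simp only: ternary_tail)
  finally have "\<bar>\<Sum>i. ?d (i + Suc k)\<bar> \<le> (1/3) ^ k / 2" by simp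
  moreover have "\<bar>?d k\<bar> = (1/3) ^ k"
    using k by (auto simp: of_bool_def)
  ultimately have "(1/3::real) ^ k / 2 \<le> \<bar>(\<Sum>i. ?d (i + Suc k)) + ?d k\<bar>"
    by linarith
  moreover have "(1/3::real) ^ J \<le> (1/3) ^ k"
    using \<open>k \<le> j\<close> \<open>j < J\<close> by (intro power_decreasing) auto
  ultimately show False
    using less unfolding eq by linarith
qed

text \<open>
  The digits of \<open>s x\<close> record which members of a countable family of balls contain \<open>x\<close>. The
  family includes finite covers by balls of every size \<open>1 / (n + 1)\<close>; agreement on the finitely
  many digits of one such cover puts two points into a common small ball. The coding itself is
  usually discontinuous; only its inverse is (uniformly) continuous.
\<close>

lemma compact_coding_by_reals:
  assumes "compact (UNIV :: 'a::metric_space set)"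
  obtains s :: "'a::metric_space \<Rightarrow> real" where "\<And>x. 0 \<le> s x" "\<And>x. s x \<le> 3/2"
    "\<And>\<epsilon>. \<epsilon> > 0 \<Longrightarrow> \<exists>\<delta>>0. \<forall>x y. \<bar>s x - s y\<bar> < \<delta> \<longrightarrow> dist x y < \<epsilon>"
proof -
  have "\<exists>S :: 'a set. finite S \<and> (\<forall>x. \<exists>a\<in>S. dist a x < 1 / real (Suc n))" for n
    by (rule compact_finite_ball_cover[OF assms, of "\<lambda>_. 1 / real (Suc n)"]) auto
  then obtain S :: "nat \<Rightarrow> 'a set" where fin: "\<And>n. finite (S n)"
    and S: "\<And>n x. \<exists>a\<in>S n. dist a x < 1 / real (Suc n)"
    by metis
  define C where "C = (\<Union>n. (\<lambda>a. ball a (1 / real (Suc n))) ` S n)"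
  have "countable C"
    unfolding C_def using fin by (auto intro: countable_finite)
  define U where "U = from_nat_into C"
  define s where "s x = (\<Sum>i. of_bool (x \<in> U i) * (1/3::real) ^ i)" for x
  have geo: "summable (\<lambda>i. (1/3::real) ^ i)"
    by (rule summable_geometric) simp
  have sum: "summable (\<lambda>i. of_bool (c i) * (1/3::real) ^ i)" for c
    by (rule summable_comparison_test'[OF geo, of 0]) (simp add: of_bool_def)
  show thesis
  proof (rule that[of s])
    show "0 \<le> s x" for x
      unfolding s_def by (intro suminf_nonneg sum) simp
    show "s x \<le> 3/2" for x
    proof -
      have "s x \<le> (\<Sum>i. (1/3::real) ^ i)"
        unfolding s_def by (intro suminf_le sum geo) (simp add: of_bool_def)
      then show ?thesis by (simp add: suminf_geometric)
    qed
    fix \<epsilon> :: real assume "\<epsilon> > 0"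
    then obtain n where n: "1 / real (Suc n) < \<epsilon> / 2"
      using nat_approx_posE[of "\<epsilon> / 2"] by auto
    have "\<exists>j. U j = ball a (1 / real (Suc n))" if "a \<in> S n" for a
      unfolding U_def using that by (intro from_nat_into_surj[OF \<open>countable C\<close>]) (auto simp: C_def)
    then obtain j where j: "\<And>a. a \<in> S n \<Longrightarrow> U (j a) = ball a (1 / real (Suc n))"
      by metis
    define J where "J = Suc (Max (insert 0 (j ` S n)))"
    have J: "j a < J" if "a \<in> S n" for a
      using that fin[of n] by (auto simp: J_def less_Suc_eq_le)
    have "dist x y < \<epsilon>" if "\<bar>s x - s y\<bar> < (1/3) ^ J / 2" for x y
    proof -
      obtain a where a: "a \<in> S n" "dist a x < 1 / real (Suc n)"
        using S by blast
      have "x \<in> U (j a) \<longleftrightarrow> y \<in> U (j a)"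
        using ternary_digits_separated[OF that[unfolded s_def] J[OF a(1)]] .
      then have "dist a x < \<epsilon> / 2" "dist a y < \<epsilon> / 2"
        using a n by (auto simp: j)
      then show ?thesis
        using dist_triangle3[of x y a] by linarith
    qed
    then show "\<exists>\<delta>>0. \<forall>x y. \<bar>s x - s y\<bar> < \<delta> \<longrightarrow> dist x y < \<epsilon>"
      by (intro exI[of _ "(1/3) ^ J / 2"]) auto
  qed
qed

text \<open>
  The uniformly continuous inverse of the coding extends to the closure of the range. Values at
  new points are limits of convergent subsequences of preimages, so compactness supplies the
  completeness that such an extension requires.
\<close>

lemma compact_decoding:
  fixes s :: "'a::metric_space \<Rightarrow> real"
  assumes "compact (UNIV :: 'a set)"
    and s: "\<And>\<epsilon>. \<epsilon> > 0 \<Longrightarrow> \<exists>\<delta>>0. \<forall>x y. \<bar>s x - s y\<bar> < \<delta> \<longrightarrow> dist x y < \<epsilon>"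
  obtains \<phi> :: "real \<Rightarrow> 'a"
  where "continuous_on (closure (range s)) \<phi>" "\<And>x. \<phi> (s x) = x"
proof -
  let ?K = "closure (range s)"
  have "\<exists>x X. (\<lambda>n. s (X n)) \<longlonglongrightarrow> t \<and> X \<longlonglongrightarrow> x" if t: "t \<in> ?K" for t
  proof -
    obtain v where v: "\<And>n. v n \<in> range s" "v \<longlonglongrightarrow> t"
      using t unfolding closure_sequential by blast
    from v(1) have "\<forall>n. \<exists>x. v n = s x" by blast
    from choice[OF this] obtain X where X: "\<And>n. v n = s (X n)" by blast
    obtain x r where r: "strict_mono r" "(X \<circ> r) \<longlonglongrightarrow> x"
      using assms(1)[THEN compact_imp_seq_compact] by (rule seq_compactE[where f = X]) simp_all
    have "(\<lambda>n. s ((X \<circ> r) n)) \<longlonglongrightarrow> t"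
      using LIMSEQ_subseq_LIMSEQ[OF v(2) r(1)] by (simp add: X comp_def)
    with r(2) show ?thesis by blast
  qed
  then obtain \<phi> X where X: "\<And>t. t \<in> ?K \<Longrightarrow> (\<lambda>n. s (X t n)) \<longlonglongrightarrow> t"
    and \<phi>: "\<And>t. t \<in> ?K \<Longrightarrow> X t \<longlonglongrightarrow> \<phi> t"
    by metis
  have modulus: "\<exists>\<delta>>0. \<forall>t\<in>?K. \<forall>x. \<bar>s x - t\<bar> < \<delta> \<longrightarrow> dist x (\<phi> t) \<le> \<epsilon>" if \<epsilon>: "\<epsilon> > 0" for \<epsilon>
  proof -
    obtain \<delta> where "\<delta> > 0" and \<delta>: "\<And>x y. \<bar>s x - s y\<bar> < \<delta> \<Longrightarrow> dist x y < \<epsilon>"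
      using s[OF \<epsilon>] by blast
    have "dist x (\<phi> t) \<le> \<epsilon>" if "t \<in> ?K" "\<bar>s x - t\<bar> < \<delta>" for t x
    proof -
      have "(\<lambda>n. \<bar>s x - s (X t n)\<bar>) \<longlonglongrightarrow> \<bar>s x - t\<bar>"
        by (intro tendsto_intros X that)
      then have "\<forall>\<^sub>F n in sequentially. \<bar>s x - s (X t n)\<bar> < \<delta>"
        using that(2) by (rule order_tendstoD)
      then have "\<forall>\<^sub>F n in sequentially. dist x (X t n) \<le> \<epsilon>"
        by (rule eventually_mono) (use \<delta> in \<open>auto intro: less_imp_le\<close>)
      moreover have "(\<lambda>n. dist x (X t n)) \<longlonglongrightarrow> dist x (\<phi> t)"
        by (intro tendsto_intros \<phi> that)
      ultimately show ?thesis
        by (intro tendsto_upperbound[where F = sequentially]) auto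
    qed
    with \<open>\<delta> > 0\<close> show ?thesis by blast
  qed
  show thesis
  proof (rule that)
    show "\<phi> (s x) = x" for x
    proof -
      have "dist x (\<phi> (s x)) \<le> \<epsilon>" if "\<epsilon> > 0" for \<epsilon>
        using modulus[OF that] closure_subset[of "range s"] by fastforce
      then have "dist x (\<phi> (s x)) \<le> 0" by (rule field_le_epsilon[where y = 0, simplified])
      then show ?thesis by simp
    qed
    show "continuous_on ?K \<phi>"
      unfolding continuous_on_iff
    proof (intro ballI allI impI)
      fix t \<epsilon> :: real assume t: "t \<in> ?K" and "\<epsilon> > 0"
      then obtain \<delta> where "\<delta> > 0"
        and \<delta>: "\<And>t x. t \<in> ?K \<Longrightarrow> \<bar>s x - t\<bar> < \<delta> \<Longrightarrow> dist x (\<phi> t) \<le> \<epsilon> / 3"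
        using modulus[of "\<epsilon> / 3"] by auto
      have "dist (\<phi> t') (\<phi> t) < \<epsilon>" if t': "t' \<in> ?K" "dist t' t < \<delta> / 2" for t'
      proof -
        obtain x where "dist (s x) t < \<delta> / 2"
          using t \<open>\<delta> > 0\<close> unfolding closure_approachable by (metis half_gt_zero imageE)
        then have "\<bar>s x - t\<bar> < \<delta>" "\<bar>s x - t'\<bar> < \<delta>"
          using t'(2) \<open>\<delta> > 0\<close> unfolding dist_real_def by linarith+
        then have "dist x (\<phi> t) \<le> \<epsilon> / 3" "dist x (\<phi> t') \<le> \<epsilon> / 3"
          using \<delta> t t'(1) by auto
        then show ?thesis
          using dist_triangle3[of "\<phi> t'" "\<phi> t" x] \<open>\<epsilon> > 0\<close> by linarith
      qed
      then show "\<exists>d>0. \<forall>t'\<in>?K. dist t' t < d \<longrightarrow> dist (\<phi> t') (\<phi> t) < \<epsilon>"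
        using \<open>\<delta> > 0\<close> by (intro exI[of _ "\<delta> / 2"]) auto
    qed
  qed
qed

text \<open>
  Sequential weak compactness, for the uniform measures on finite families of points. The codes
  of the points lie in one bounded interval, so their distributions on the reals are tight and
  Helly's theorem applies. The limit is carried by the closure of the set of codes, where
  decoding is continuous; its image under decoding is the required measure, because a continuous
  \<open>f\<close> composed with decoding extends by Tietze to a bounded continuous function on the reals.
\<close>

lemma empirical_measures_subsequence:
  fixes u :: "nat \<Rightarrow> nat \<Rightarrow> 'a::metric_space" and n :: "nat \<Rightarrow> nat"
  assumes compact: "compact (UNIV :: 'a set)" and n: "\<And>k. n k > 0"
  obtains \<mu> :: "'a measure" and r :: "nat \<Rightarrow> nat"
  where "strict_mono r" "prob_space \<mu>" "sets \<mu> = sets borel"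
    "\<And>f :: 'a \<Rightarrow> real. continuous_on UNIV f \<Longrightarrow>
       (\<lambda>k. (\<Sum>i<n (r k). f (u (r k) i)) / real (n (r k))) \<longlonglongrightarrow> integral\<^sup>L \<mu> f"
proof -
  obtain s :: "'a \<Rightarrow> real" where s: "\<And>x. 0 \<le> s x" "\<And>x. s x \<le> 3/2"
    "\<And>\<epsilon>. \<epsilon> > 0 \<Longrightarrow> \<exists>\<delta>>0. \<forall>x y. \<bar>s x - s y\<bar> < \<delta> \<longrightarrow> dist x y < \<epsilon>"
    using compact_coding_by_reals[OF compact] by blast
  let ?K = "closure (range s)"
  obtain \<phi> :: "real \<Rightarrow> 'a" where \<phi>: "continuous_on ?K \<phi>" "\<And>x. \<phi> (s x) = x"
    using compact_decoding[OF compact s(3)] by blast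
  let ?C = "\<lambda>k. uniform_count_measure {..<n k}"
  define E where "E k = distr (?C k) borel (\<lambda>i. s (u k i))" for k
  have meas: "g \<in> measurable (?C k) borel" for g :: "nat \<Rightarrow> real" and k
    by (simp add: measurable_def sets_uniform_count_measure space_uniform_count_measure)
  have distribution: "real_distribution (E k)" for k
    unfolding E_def real_distribution_def real_distribution_axioms_def
    using prob_space_uniform_count_measure[of "{..<n k}"] n[of k]
    by (auto intro!: prob_space.prob_space_distr meas)
  have integral_E: "integral\<^sup>L (E k) g = (\<Sum>i<n k. g (s (u k i))) / real (n k)"
    if "g \<in> borel_measurable borel" for g :: "real \<Rightarrow> real" and k
    unfolding E_def using that by (simp add: integral_distr[OF meas] integral_uniform_count_measure)
  have "measure (E k) {-1<..2} = 1" for k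
  proof -
    interpret real_distribution "E k" by (rule distribution)
    have "(\<lambda>i. s (u k i)) -` {-1<..2} \<inter> space (?C k) = space (?C k)"
      using s(1,2) by (force simp: intro: less_le_trans[of "-1" 0] order_trans[of _ "3/2"])
    then have "measure (E k) {-1<..2} = measure (?C k) (space (?C k))"
      unfolding E_def by (subst measure_distr[OF meas]) auto
    also have "\<dots> = 1"
      using prob_space_uniform_count_measure[of "{..<n k}"] n[of k]
      by (intro prob_space.prob_space) auto
    finally show ?thesis .
  qed
  then have "tight E"
    unfolding tight_def using distribution
    by (intro conjI allI impI exI[of _ "-1"] exI[of _ 2]) auto
  from tight_imp_convergent_subsubsequence[OF this strict_mono_id]
  obtain r M where r: "strict_mono r" and M: "real_distribution M" and weak: "weak_conv_m (E \<circ> r) M"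
    by auto
  interpret M: real_distribution M by (rule M)
  have conv: "(\<lambda>k. (\<Sum>i<n (r k). g (s (u (r k) i))) / real (n (r k))) \<longlonglongrightarrow> integral\<^sup>L M g"
    if "continuous_on UNIV g" "\<And>t. norm (g t) \<le> B" for g :: "real \<Rightarrow> real" and B
  proof -
    have "(\<lambda>k. integral\<^sup>L ((E \<circ> r) k) g) \<longlonglongrightarrow> integral\<^sup>L M g"
      by (rule weak_conv_imp_integral_bdd_continuous_conv[OF _ M weak _ that(2)])
         (use distribution that(1) in \<open>auto simp: continuous_on_eq_continuous_at\<close>)
    then show ?thesis
      using integral_E[OF borel_measurable_continuous_onI[OF that(1)]] by simp
  qed
  have "?K \<noteq> {}" by simp
  \<comment> \<open>The truncated distance to \<open>?K\<close> is a bounded continuous function that vanishes at all codes,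
      so its integral against the limit is 0.\<close>
  have AE_K: "AE t in M. t \<in> ?K"
  proof -
    let ?h = "\<lambda>t. min 1 (infdist t ?K)"
    have cont: "continuous_on UNIV ?h" by (intro continuous_intros)
    have [measurable]: "?h \<in> borel_measurable borel"
      by (rule borel_measurable_continuous_onI[OF cont])
    have "s x \<in> ?K" for x using closure_subset[of "range s"] by auto
    then have "(\<lambda>k. 0) \<longlonglongrightarrow> integral\<^sup>L M ?h"
      using conv[OF cont, of 1] by (simp add: infdist_nonneg)
    then have "integral\<^sup>L M ?h = 0"
      by (simp add: LIMSEQ_const_iff)
    moreover have "integrable M ?h"
      by (rule M.integrable_const_bound[of _ 1]) (auto simp: infdist_nonneg)
    ultimately have "AE t in M. ?h t = 0"
      by (subst (asm) integral_nonneg_eq_0_iff_AE) (auto simp: infdist_nonneg)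
    then show ?thesis
    proof eventually_elim
      case (elim t)
      then have "infdist t ?K = 0" by (auto simp: min_def split: if_splits)
      then show ?case using in_closed_iff_infdist_zero[OF closed_closure \<open>?K \<noteq> {}\<close>] by blast
    qed
  qed
  \<comment> \<open>Off \<open>?K\<close>, a null set, only measurability matters, so any constant value will do.\<close>
  define \<psi> where "\<psi> t = (if t \<in> ?K then \<phi> t else \<phi> 0)" for t
  have \<psi>[measurable]: "\<psi> \<in> measurable M borel"
    unfolding \<psi>_def M.events_eq_borel[THEN measurable_cong_sets, OF refl]
    by (intro borel_measurable_continuous_on_if \<phi>(1)) auto
  show thesis
  proof (rule that[OF r])
    show "prob_space (distr M borel \<psi>)" by (rule M.prob_space_distr[OF \<psi>])
    show "sets (distr M borel \<psi>) = sets borel" by simp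
    fix f :: "'a \<Rightarrow> real" assume f: "continuous_on UNIV f"
    have [measurable]: "f \<in> borel_measurable borel" by (rule borel_measurable_continuous_onI[OF f])
    have "bounded (range f)"
      using compact_continuous_image[OF f compact] by (rule compact_imp_bounded)
    then obtain B where "B > 0" and B: "\<And>x. norm (f x) \<le> B"
      unfolding bounded_pos by auto
    have "continuous_on ?K (\<lambda>t. f (\<phi> t))"
      by (rule continuous_on_compose2[OF f \<phi>(1)]) auto
    then obtain g where g: "continuous_on UNIV g" "\<And>t. t \<in> ?K \<Longrightarrow> g t = f (\<phi> t)" "\<And>t. norm (g t) \<le> B"
      using Tietze[of ?K "\<lambda>t. f (\<phi> t)" UNIV B] B \<open>B > 0\<close> by auto
    have [measurable]: "g \<in> borel_measurable borel" by (rule borel_measurable_continuous_onI[OF g(1)])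
    have "g (s x) = f x" for x
      using g(2)[of "s x"] closure_subset[of "range s"] \<phi>(2) by auto
    moreover have "integral\<^sup>L M g = integral\<^sup>L M (\<lambda>t. f (\<psi> t))"
    proof (rule integral_cong_AE)
      show "AE t in M. g t = f (\<psi> t)"
        using AE_K by eventually_elim (simp add: g(2) \<psi>_def)
    qed measurable
    then have "integral\<^sup>L M g = integral\<^sup>L (distr M borel \<psi>) f"
      by (simp add: integral_distr)
    ultimately show "(\<lambda>k. (\<Sum>i<n (r k). f (u (r k) i)) / real (n (r k))) \<longlonglongrightarrow> integral\<^sup>L (distr M borel \<psi>) f"
      using conv[OF g(1,3)] by simp
  qed
qed

text \<open>
  The functions \<open>max 0 (1 - k d(x, A))\<close> decrease to the indicator of a closed set \<open>A\<close>, so the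
  integrals determine the measure of closed sets, an intersection-stable generator.
\<close>

lemma prob_measure_eqI_continuous:
  fixes M N :: "'a::metric_space measure"
  assumes M: "prob_space M" "sets M = sets borel" and N: "prob_space N" "sets N = sets borel"
    and eq: "\<And>f :: 'a \<Rightarrow> real. continuous_on UNIV f \<Longrightarrow> (\<And>x. \<bar>f x\<bar> \<le> 1) \<Longrightarrow> integral\<^sup>L M f = integral\<^sup>L N f"
  shows "M = N"
proof -
  interpret M: prob_space M by (rule M)
  interpret N: prob_space N by (rule N)
  have "measure M A = measure N A" if "closed A" "A \<noteq> {}" for A
  proof -
    let ?f = "\<lambda>k x. max 0 (1 - real k * infdist x A)"
    have cont: "continuous_on UNIV (?f k)" for k by (intro continuous_intros)
    have lim: "(\<lambda>k. ?f k x) \<longlonglongrightarrow> indicator A x" for x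
    proof (cases "x \<in> A")
      case False
      then have "infdist x A > 0"
        using in_closed_iff_infdist_zero[OF that] infdist_nonneg[of x A] by fastforce
      then obtain k0 where k0: "1 < real k0 * infdist x A"
        using reals_Archimedean3 by blast
      have "?f k x = 0" if "k \<ge> k0" for k
      proof -
        have "real k0 * infdist x A \<le> real k * infdist x A"
          using that by (intro mult_right_mono) (auto simp: infdist_nonneg)
        with k0 show ?thesis by simp
      qed
      then show ?thesis
        using False by (intro tendsto_eventually) (auto simp: eventually_sequentially)
    qed simp
    have *: "(\<lambda>k. integral\<^sup>L P (?f k)) \<longlonglongrightarrow> measure P A"
      if "prob_space P" "sets P = sets borel" for P
    proof -
      interpret P: prob_space P by fact
      have A: "A \<in> sets P" using \<open>closed A\<close> that(2) by simp
      have "(\<lambda>k. integral\<^sup>L P (?f k)) \<longlonglongrightarrow> integral\<^sup>L P (indicator A :: 'a \<Rightarrow> real)"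
      proof (rule integral_dominated_convergence[where w = "\<lambda>_. 1"])
        show "?f k \<in> borel_measurable P" for k
          using borel_measurable_continuous_onI[OF cont] that(2) by (simp cong: measurable_cong_sets)
        show "(indicator A :: 'a \<Rightarrow> real) \<in> borel_measurable P" using A by simp
      qed (use lim in \<open>auto simp: infdist_nonneg\<close>)
      then show ?thesis using A by simp
    qed
    have "integral\<^sup>L M (?f k) = integral\<^sup>L N (?f k)" for k
      by (rule eq[OF cont]) (simp add: infdist_nonneg)
    with *[OF M] *[OF N] show ?thesis
      by (simp add: LIMSEQ_unique)
  qed
  then have closed: "emeasure M A = emeasure N A" if "closed A" for A
    using that by (cases "A = {}") (auto simp: M.emeasure_eq_measure N.emeasure_eq_measure)
  have borel: "sets borel = sigma_sets UNIV (Collect (closed :: 'a set \<Rightarrow> bool))"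
    by (subst borel_eq_closed) simp
  show ?thesis
    by (rule measure_eqI_generator_eq[where \<Omega> = UNIV and E = "Collect closed" and A = "\<lambda>_. UNIV"])
       (use closed M(2) N(2) borel in \<open>auto simp: Int_stable_def\<close>)
qed

section \<open>Uniform convergence of time averages\<close>

text \<open>
  A failure at every length yields orbit segments whose empirical measures have an invariant
  limit, which must be \<open>\<nu>\<close> although its integral of \<open>f\<close> is wrong.
\<close>

lemma uniform_ergodic_averages:
  fixes \<tau> :: "'a::metric_space \<Rightarrow> 'a" and f :: "'a \<Rightarrow> real"
  assumes compact: "compact (UNIV :: 'a set)" and \<tau>: "continuous_on UNIV \<tau>"
    and unique: "uniquely_ergodic \<tau>" and \<nu>: "invariant_prob \<tau> \<nu>"
    and f: "continuous_on UNIV f" and "\<epsilon> > 0"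
  shows "\<exists>m>0. \<forall>x. \<bar>(\<Sum>j<m. f ((\<tau> ^^ j) x)) / real m - integral\<^sup>L \<nu> f\<bar> < \<epsilon>"
proof (rule ccontr)
  assume "\<not> ?thesis"
  then have "\<forall>k. \<exists>x. \<epsilon> \<le> \<bar>(\<Sum>j<Suc k. f ((\<tau> ^^ j) x)) / real (Suc k) - integral\<^sup>L \<nu> f\<bar>"
    by (meson not_less zero_less_Suc)
  then obtain x where x: "\<And>k. \<epsilon> \<le> \<bar>(\<Sum>j<Suc k. f ((\<tau> ^^ j) (x k))) / real (Suc k) - integral\<^sup>L \<nu> f\<bar>"
    by metis
  obtain \<mu> r where r: "strict_mono (r :: nat \<Rightarrow> nat)" and \<mu>: "prob_space \<mu>" "sets \<mu> = sets borel"
    and lim: "\<And>g :: 'a \<Rightarrow> real. continuous_on UNIV g \<Longrightarrow>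
       (\<lambda>k. (\<Sum>j<Suc (r k). g ((\<tau> ^^ j) (x (r k)))) / real (Suc (r k))) \<longlonglongrightarrow> integral\<^sup>L \<mu> g"
    by (rule empirical_measures_subsequence[OF compact, of Suc "\<lambda>k j. (\<tau> ^^ j) (x k)"]) auto
  have \<tau>_meas: "\<tau> \<in> measurable \<mu> borel"
    using borel_measurable_continuous_onI[OF \<tau>] \<mu>(2) by (simp cong: measurable_cong_sets)
  have space: "space \<mu> = UNIV"
    using sets_eq_imp_space_eq[OF \<mu>(2)] by simp
  have "distr \<mu> borel \<tau> = \<mu>"
  proof (rule prob_measure_eqI_continuous)
    show "prob_space (distr \<mu> borel \<tau>)" by (rule prob_space.prob_space_distr[OF \<mu>(1) \<tau>_meas])
    fix g :: "'a \<Rightarrow> real" assume g: "continuous_on UNIV g" and bound: "\<And>x. \<bar>g x\<bar> \<le> 1"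
    have g\<tau>: "continuous_on UNIV (\<lambda>x. g (\<tau> x))"
      by (rule continuous_on_compose2[OF g \<tau>]) auto
    let ?A = "\<lambda>g k. (\<Sum>j<Suc (r k). g ((\<tau> ^^ j) (x (r k)))) / real (Suc (r k)) :: real"
    have telescope: "\<bar>?A (\<lambda>x. g (\<tau> x)) k - ?A g k\<bar> \<le> 2 * inverse (real (Suc k))" for k
    proof -
      let ?y = "x (r k)" and ?n = "Suc (r k)"
      have "(\<Sum>j<?n. g (\<tau> ((\<tau> ^^ j) ?y))) - (\<Sum>j<?n. g ((\<tau> ^^ j) ?y)) = g ((\<tau> ^^ ?n) ?y) - g ?y"
        using sum_lessThan_telescope[of "\<lambda>j. g ((\<tau> ^^ j) ?y)" ?n] by (simp only: sum_subtractf) simp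
      then have "\<bar>?A (\<lambda>x. g (\<tau> x)) k - ?A g k\<bar> = \<bar>g ((\<tau> ^^ ?n) ?y) - g ?y\<bar> / real ?n"
        by (simp only: diff_divide_distrib[symmetric] abs_divide abs_of_nat)
      also have "\<dots> \<le> 2 / real (Suc k)"
        using bound[of "(\<tau> ^^ ?n) ?y"] bound[of ?y] seq_suble[OF r, of k]
        by (intro frac_le) auto
      finally show ?thesis by (simp add: divide_inverse)
    qed
    have "(\<lambda>k. 2 * inverse (real (Suc k))) \<longlonglongrightarrow> 0"
      using tendsto_mult_right_zero[OF LIMSEQ_inverse_real_of_nat] .
    then have "(\<lambda>k. ?A (\<lambda>x. g (\<tau> x)) k - ?A g k) \<longlonglongrightarrow> 0"
      by (rule Lim_null_comparison[rotated])
         (intro always_eventually allI, unfold real_norm_def, rule telescope)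
    moreover have "(\<lambda>k. ?A (\<lambda>x. g (\<tau> x)) k - ?A g k) \<longlonglongrightarrow>
        integral\<^sup>L \<mu> (\<lambda>x. g (\<tau> x)) - integral\<^sup>L \<mu> g"
      by (intro tendsto_diff lim g g\<tau>)
    ultimately have "integral\<^sup>L \<mu> (\<lambda>x. g (\<tau> x)) - integral\<^sup>L \<mu> g = 0"
      by (rule LIMSEQ_unique[symmetric])
    then show "integral\<^sup>L (distr \<mu> borel \<tau>) g = integral\<^sup>L \<mu> g"
      using integral_distr[OF \<tau>_meas borel_measurable_continuous_onI[OF g]] by simp
  qed (use \<mu> in auto)
  then have "measure \<mu> (\<tau> -` A) = measure \<mu> A" if "A \<in> sets borel" for A
    using measure_distr[OF \<tau>_meas that] by (simp add: space)
  then have "invariant_prob \<tau> \<mu>"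
    using \<mu> by (simp add: invariant_prob_def)
  then have "\<mu> = \<nu>"
    using unique \<nu> unfolding uniquely_ergodic_def by blast
  have "\<epsilon> \<le> \<bar>integral\<^sup>L \<mu> f - integral\<^sup>L \<nu> f\<bar>"
    using x by (intro LIMSEQ_le_const[OF tendsto_rabs[OF tendsto_diff[OF lim[OF f] tendsto_const]]]) blast
  with \<open>\<mu> = \<nu>\<close> \<open>\<epsilon> > 0\<close> show False by simp
qed

section \<open>Transfer of valid formulas\<close>

text \<open>
  Transfer is postulated only for assignments with values in the standard part. A formula that is
  valid under all standard assignments is moved to arbitrary elements of the extension by first
  quantifying all its variables; for this it suffices to bound the variables that occur in it,
  bound ones included.
\<close>

primrec var_bound :: "'u formula \<Rightarrow> nat" where
  "var_bound (Eq i j) = Suc (max i j)"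
| "var_bound (Atom R vs) = Suc (Max (insert 0 (set vs)))"
| "var_bound (Neg \<phi>) = var_bound \<phi>"
| "var_bound (Conj \<phi> \<psi>) = max (var_bound \<phi>) (var_bound \<psi>)"
| "var_bound (Exi i \<phi>) = max (Suc i) (var_bound \<phi>)"

lemma sat_cong:
  "(\<And>i. i < var_bound \<phi> \<Longrightarrow> e i = e' i) \<Longrightarrow> sat I e \<phi> \<longleftrightarrow> sat I e' \<phi>"
proof (induction \<phi> arbitrary: e e')
  case (Atom R vs)
  have "map e vs = map e' vs"
    by (rule map_cong[OF refl], rule Atom) (auto simp: less_Suc_eq_le)
  then show ?case by (simp only: sat.simps)
next
  case (Neg \<phi>)
  have "sat I e \<phi> \<longleftrightarrow> sat I e' \<phi>"
    by (rule Neg.IH) (simp add: Neg.prems)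
  then show ?case by simp
next
  case (Conj \<phi> \<psi>)
  have "sat I e \<phi> \<longleftrightarrow> sat I e' \<phi>" "sat I e \<psi> \<longleftrightarrow> sat I e' \<psi>"
    by (rule Conj.IH, simp add: Conj.prems)+
  then show ?case by simp
next
  case (Exi i \<phi>)
  have "sat I (e(i := a)) \<phi> \<longleftrightarrow> sat I (e'(i := a)) \<phi>" for a
    by (rule Exi.IH) (simp add: Exi.prems)
  then show ?case by simp
qed simp_all

definition Forall :: "nat \<Rightarrow> 'u formula \<Rightarrow> 'u formula" where
  "Forall i \<phi> = Neg (Exi i (Neg \<phi>))"

definition Imp :: "'u formula \<Rightarrow> 'u formula \<Rightarrow> 'u formula"  (infixr \<open>\<^bold>\<longrightarrow>\<close> 25) where
  "Imp \<phi> \<psi> = Neg (Conj \<phi> (Neg \<psi>))"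

lemma sat_Forall [simp]: "sat I e (Forall i \<phi>) \<longleftrightarrow> (\<forall>a. sat I (e(i := a)) \<phi>)"
  by (simp add: Forall_def)

lemma sat_Imp [simp]: "sat I e (\<phi> \<^bold>\<longrightarrow> \<psi>) \<longleftrightarrow> (sat I e \<phi> \<longrightarrow> sat I e \<psi>)"
  by (simp add: Imp_def)

primrec close_below :: "nat \<Rightarrow> 'u formula \<Rightarrow> 'u formula" where
  "close_below 0 \<phi> = \<phi>"
| "close_below (Suc n) \<phi> = Forall n (close_below n \<phi>)"

lemma sat_close_below:
  "sat I e (close_below n \<phi>) \<longleftrightarrow> (\<forall>e'. (\<forall>i\<ge>n. e' i = e i) \<longrightarrow> sat I e' \<phi>)"
proof (induction n arbitrary: e)
  case 0
  have "(\<forall>i\<ge>0. e' i = e i) \<longleftrightarrow> e' = e" for e'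
    by (simp add: fun_eq_iff)
  then show ?case by simp
next
  case (Suc n)
  show ?case
  proof
    assume *: "sat I e (close_below (Suc n) \<phi>)"
    show "\<forall>e'. (\<forall>i\<ge>Suc n. e' i = e i) \<longrightarrow> sat I e' \<phi>"
    proof (intro allI impI)
      fix e' assume e': "\<forall>i\<ge>Suc n. e' i = e i"
      have "sat I (e(n := e' n)) (close_below n \<phi>)"
        using * by simp
      moreover have "\<forall>i\<ge>n. e' i = (e(n := e' n)) i"
        using e' by (auto simp: Suc_le_eq)
      ultimately show "sat I e' \<phi>" using Suc.IH by blast
    qed
  next
    assume *: "\<forall>e'. (\<forall>i\<ge>Suc n. e' i = e i) \<longrightarrow> sat I e' \<phi>"
    show "sat I e (close_below (Suc n) \<phi>)"
      using * by (auto simp: Suc.IH)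
  qed
qed

text \<open>
  The standard relations whose extensions define \<^const>\<open>elems\<close>, \<^const>\<open>apply_map\<close>,
  \<^const>\<open>internal_permutation\<close>, \<^const>\<open>star_restrict\<close> and \<^const>\<open>hyper_average\<close>, together
  with their specialisation to maps of a set into itself and to averages of a fixed standard
  length.
\<close>

abbreviation elem_rel :: "'a entity list set" where
  "elem_rel \<equiv> {[Pt p, PSet A] | p A. p \<in> A}"

abbreviation apply_rel :: "'a entity list set" where
  "apply_rel \<equiv> {[PMap m, Pt p, Pt q] | m p q. m p = Some q}"

abbreviation dom_rel :: "'a entity list set" where
  "dom_rel \<equiv> {[PMap m, PSet (dom m)] | m. True}"

abbreviation self_map_rel :: "'a entity list set" where
  "self_map_rel \<equiv> {[PMap m, PSet (dom m)] | m. ran m \<subseteq> dom m}"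

abbreviation restrict_rel :: "('a \<Rightarrow> real) \<Rightarrow> 'a entity list set" where
  "restrict_rel f \<equiv> {[PSet A, RMap ((Some \<circ> f) |` A)] | A. True}"

abbreviation average_rel :: "'a entity list set" where
  "average_rel \<equiv> {[Idx n, RMap g, PMap m, Pt p, Num (average n g m p)] | n g m p. True}"

abbreviation average_at_rel :: "nat \<Rightarrow> 'a entity list set" where
  "average_at_rel m \<equiv> {[RMap g, PMap t, Pt p, Num (average m g t p)] | g t p. True}"

locale transfer_extension =
  fixes \<U> :: "('u, 'w) extension"
  assumes transfer: "transfer_principle \<U>"
begin

text \<open>
  Validity under standard assignments passes to arbitrary nonstandard ones. Applications follow one
  pattern: the elements concerned are listed, the assignment is the indexing function of the list,
  and the formula names them by position.
\<close>

lemma transfer_valid: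
  assumes "\<And>e. sat (\<lambda>R. R) e \<phi>"
  shows "sat (rel \<U>) e \<phi>"
proof -
  let ?n = "var_bound \<phi>" and ?e = "\<lambda>_. undefined :: 'u"
  let ?e' = "\<lambda>i. if i < ?n then e i else emb \<U> (?e i)"
  have "sat (\<lambda>R. R) ?e (close_below ?n \<phi>)"
    using assms by (simp add: sat_close_below)
  then have "sat (rel \<U>) (emb \<U> \<circ> ?e) (close_below ?n \<phi>)"
    using transfer unfolding transfer_principle_def by blast
  then have "sat (rel \<U>) ?e' \<phi>"
    unfolding sat_close_below by (elim allE[of _ ?e']) auto
  then show ?thesis
    by (subst sat_cong[of \<phi> e ?e']) auto
qed

text \<open>
  Standard elements are definable by singleton relations, so formulas may mention them as values
  of ordinary variables, constrained by such a singleton.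
\<close>

lemma rel_singleton_iff: "[w] \<in> rel \<U> {[a]} \<longleftrightarrow> w = emb \<U> a"
proof -
  let ?\<phi> = "Forall 0 (Atom {[a]} [0] \<^bold>\<longrightarrow> Eq 0 1)" and ?\<psi> = "Atom {[a]} [1]"
  have "sat (\<lambda>R. R) (\<lambda>_. a) ?\<phi>" "sat (\<lambda>R. R) (\<lambda>_. a) ?\<psi>"
    by auto
  then have \<phi>: "sat (rel \<U>) (emb \<U> \<circ> (\<lambda>_. a)) ?\<phi>"
    and \<psi>: "sat (rel \<U>) (emb \<U> \<circ> (\<lambda>_. a)) ?\<psi>"
    using transfer unfolding transfer_principle_def by blast+
  have "sat (rel \<U>) ((emb \<U> \<circ> (\<lambda>_. a))(0 := w)) (Atom {[a]} [0] \<^bold>\<longrightarrow> Eq 0 1)"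
    using \<phi> unfolding sat_Forall by (rule spec)
  then have "[w] \<in> rel \<U> {[a]} \<longrightarrow> w = emb \<U> a"
    by simp
  moreover have "[emb \<U> a] \<in> rel \<U> {[a]}"
    using \<psi> by simp
  ultimately show ?thesis by blast
qed

lemma rel_emb: "[emb \<U> a] \<in> rel \<U> {[a]}"
  by (simp add: rel_singleton_iff)

end

section \<open>Standard parts\<close>

locale transfer_over_space =
  transfer_extension \<U> for \<U> :: "('a::metric_space entity, 'w) extension"
begin

text \<open>
  An extension of a relation between numbers contains no pair with a standard point in it, so only
  the first disjunct in the definition of \<^const>\<open>infinitely_close\<close> is possible here.
\<close>

lemma infinitely_close_Pt_iff:
  "infinitely_close \<U> v (emb \<U> (Pt a)) \<longleftrightarrow>
     (\<forall>\<epsilon>>0. [v] \<in> rel \<U> {[Pt p] | p. dist p a < \<epsilon>})"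
proof -
  have "[v, emb \<U> (Pt a)] \<in> rel \<U> {[Pt p, Pt q] | p q. dist p q < \<epsilon>} \<or>
        [v, emb \<U> (Pt a)] \<in> rel \<U> {[Num r, Num s] | r s. dist r s < \<epsilon>} \<longleftrightarrow>
        [v] \<in> rel \<U> {[Pt p] | p. dist p a < \<epsilon>}" for \<epsilon> :: real
  proof -
    let ?a = "Atom {[Pt a]} [1]" and ?e = "(!) [v, emb \<U> (Pt a)]"
    let ?P = "Atom {[Pt p, Pt q] | p q. dist p q < \<epsilon>} [0, 1]"
    let ?N = "Atom {[Num r, Num s] | r s. dist r s < \<epsilon>} [0, 1]"
    let ?B = "Atom {[Pt p] | p. dist p a < \<epsilon>} [0]"
    have "sat (rel \<U>) ?e (?a \<^bold>\<longrightarrow> ?P \<^bold>\<longrightarrow> ?B)"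
         "sat (rel \<U>) ?e (?a \<^bold>\<longrightarrow> ?B \<^bold>\<longrightarrow> ?P)"
         "sat (rel \<U>) ?e (?a \<^bold>\<longrightarrow> Neg ?N)"
      by (rule transfer_valid, force)+
    then show ?thesis by (auto simp: rel_emb)
  qed
  then show ?thesis unfolding infinitely_close_def by simp
qed

lemma infinitely_close_NumI:
  assumes "\<And>\<epsilon>. \<epsilon> > 0 \<Longrightarrow> [v] \<in> rel \<U> {[Num r] | r. \<bar>r - c\<bar> < \<epsilon>}"
  shows "infinitely_close \<U> v (emb \<U> (Num c))"
  unfolding infinitely_close_def
proof (intro allI impI disjI2)
  fix \<epsilon> :: real assume "\<epsilon> > 0"
  have "sat (rel \<U>) ((!) [v, emb \<U> (Num c)])
     (Atom {[Num c]} [1] \<^bold>\<longrightarrow> Atom {[Num r] | r. \<bar>r - c\<bar> < \<epsilon>} [0] \<^bold>\<longrightarrow>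
      Atom {[Num r, Num s] | r s. dist r s < \<epsilon>} [0, 1])"
    by (rule transfer_valid) (auto simp: dist_real_def)
  then show "[v, emb \<U> (Num c)] \<in> rel \<U> {[Num r, Num s] | r s. dist r s < \<epsilon>}"
    using assms[OF \<open>\<epsilon> > 0\<close>] by (simp add: rel_emb)
qed

lemma rel_Union_finite:
  assumes "finite S" "[v] \<in> rel \<U> {[x] | x. \<exists>i\<in>S. P i x}"
  shows "\<exists>i\<in>S. [v] \<in> rel \<U> {[x] | x. P i x}"
  using assms
proof (induction S)
  case empty
  have "sat (rel \<U>) ((!) [v]) (Neg (Atom {[x] | x. \<exists>i\<in>{}. P i x} [0]))"
    by (rule transfer_valid) auto
  with empty show ?case by simp
next
  case (insert j S)
  have "sat (rel \<U>) ((!) [v])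
     (Atom {[x] | x. \<exists>i\<in>insert j S. P i x} [0] \<^bold>\<longrightarrow> Neg (Atom {[x] | x. P j x} [0]) \<^bold>\<longrightarrow>
      Atom {[x] | x. \<exists>i\<in>S. P i x} [0])"
    by (rule transfer_valid) auto
  then show ?case using insert by fastforce
qed

text \<open>
  If \<open>v\<close> were infinitely close to no standard point, each standard \<open>a\<close> would have a ball whose
  extension misses \<open>v\<close>. Finitely many of these balls cover the space, and the extension of a
  finite union is the union of the extensions.
\<close>

lemma compact_imp_nearstandard:
  assumes "compact (UNIV :: 'a set)" "[v] \<in> rel \<U> {[Pt p] | p. True}"
  shows "\<exists>a. infinitely_close \<U> v (emb \<U> (Pt a))"
proof (rule ccontr)
  assume "\<nexists>a. infinitely_close \<U> v (emb \<U> (Pt a))"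
  then have "\<forall>a. \<exists>\<epsilon>>0. [v] \<notin> rel \<U> {[Pt p] | p. dist p a < \<epsilon>}"
    by (simp add: infinitely_close_Pt_iff)
  then obtain r where "\<forall>a. r a > 0 \<and> [v] \<notin> rel \<U> {[Pt p] | p. dist p a < r a}"
    using choice[of "\<lambda>a \<epsilon>. \<epsilon> > 0 \<and> [v] \<notin> rel \<U> {[Pt p] | p. dist p a < \<epsilon>}"] by blast
  then have r: "\<And>a. r a > 0" "\<And>a. [v] \<notin> rel \<U> {[Pt p] | p. dist p a < r a}"
    by blast+
  obtain S where S: "finite S" "\<And>p. \<exists>a\<in>S. dist a p < r a"
    using compact_finite_ball_cover[OF assms(1), of r] r(1) by blast
  have "sat (rel \<U>) ((!) [v]) (Atom {[Pt p] | p. True} [0] \<^bold>\<longrightarrow>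
      Atom {[x] | x. \<exists>a\<in>S. \<exists>p. x = Pt p \<and> dist p a < r a} [0])"
    by (rule transfer_valid) (use S(2) in \<open>auto simp: dist_commute\<close>)
  then have "[v] \<in> rel \<U> {[x] | x. \<exists>a\<in>S. \<exists>p. x = Pt p \<and> dist p a < r a}"
    using assms(2) by simp
  from rel_Union_finite[OF S(1) this] obtain a
    where "[v] \<in> rel \<U> {[x] | x. \<exists>p. x = Pt p \<and> dist p a < r a}" by blast
  also have "{[x] | x. \<exists>p. x = Pt p \<and> dist p a < r a} = {[Pt p] | p. dist p a < r a}"
    by auto
  finally show False using r(2) by blast
qed

lemma infinitely_close_Pt_unique:
  assumes "infinitely_close \<U> v (emb \<U> (Pt a))" "infinitely_close \<U> v (emb \<U> (Pt b))"
  shows "a = b"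
proof (rule ccontr)
  assume "a \<noteq> b"
  define \<epsilon> where "\<epsilon> = dist a b / 2"
  have "\<epsilon> > 0" using \<open>a \<noteq> b\<close> by (simp add: \<epsilon>_def)
  have disj: False if "dist p a < \<epsilon>" "dist p b < \<epsilon>" for p
    using dist_triangle2[of a b p] that by (simp add: \<epsilon>_def dist_commute)
  have "sat (rel \<U>) ((!) [v]) (Atom {[Pt p] | p. dist p a < \<epsilon>} [0] \<^bold>\<longrightarrow>
      Neg (Atom {[Pt p] | p. dist p b < \<epsilon>} [0]))"
    by (rule transfer_valid) (use disj in auto)
  then show False using assms \<open>\<epsilon> > 0\<close> by (auto simp: infinitely_close_Pt_iff)
qed

lemma rel_ball_st:
  assumes "compact (UNIV :: 'a set)" "v \<in> elems \<U> Y" "\<epsilon> > 0"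
  shows "[v] \<in> rel \<U> {[Pt p] | p. dist p (st \<U> v) < \<epsilon>}"
proof -
  have "sat (rel \<U>) ((!) [v, Y]) (Atom elem_rel [0, 1] \<^bold>\<longrightarrow> Atom {[Pt p] | p. True} [0])"
    by (rule transfer_valid) auto
  then have "[v] \<in> rel \<U> {[Pt p] | p. True}"
    using assms(2) by (simp add: elems_def)
  from compact_imp_nearstandard[OF assms(1) this]
  obtain a where a: "infinitely_close \<U> v (emb \<U> (Pt a))" ..
  then have "infinitely_close \<U> v (emb \<U> (Pt (st \<U> v)))"
    unfolding st_def by (rule theI) (rule infinitely_close_Pt_unique[OF _ a])
  then show ?thesis using assms(3) by (simp add: infinitely_close_Pt_iff)
qed

section \<open>Internal maps and their averages\<close>

text \<open>
  Together with \<open>star_restrict_rel\<close> and \<open>hyper_average_rel\<close>, this turns the definite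
  descriptions behind values, restrictions and averages into membership in the extensions of
  standard relations: unique existence transfers.
\<close>

lemma apply_map_rel:
  assumes "[T, Y] \<in> rel \<U> dom_rel" "v \<in> elems \<U> Y"
  shows "[T, v, w] \<in> rel \<U> apply_rel \<longleftrightarrow> w = apply_map \<U> T v"
proof -
  have "sat (rel \<U>) ((!) [T, Y, v])
     (Atom dom_rel [0, 1] \<^bold>\<longrightarrow> Atom elem_rel [2, 1] \<^bold>\<longrightarrow> Exi 3 (Atom apply_rel [0, 2, 3]))"
    by (rule transfer_valid) auto
  then obtain u where u: "[T, v, u] \<in> rel \<U> apply_rel"
    using assms by (auto simp: elems_def)
  have uniq: "x = x'" if "[T, v, x] \<in> rel \<U> apply_rel" "[T, v, x'] \<in> rel \<U> apply_rel" for x x'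
  proof -
    have "sat (rel \<U>) ((!) [T, v, x, x'])
       (Atom apply_rel [0, 1, 2] \<^bold>\<longrightarrow> Atom apply_rel [0, 1, 3] \<^bold>\<longrightarrow> Eq 2 3)"
      by (rule transfer_valid) auto
    with that show ?thesis by simp
  qed
  have "apply_map \<U> T v = u"
    unfolding apply_map_def using u uniq by (intro the_equality) auto
  with u uniq show ?thesis by blast
qed

text \<open>
  Mapping \<open>elems \<U> Y\<close> into itself is a first-order property of \<open>T\<close> and \<open>Y\<close>, so it amounts to
  membership in the extension of a standard relation, in which form it can enter transferred
  formulas.
\<close>

lemma self_map_relI:
  assumes "[T, Y] \<in> rel \<U> dom_rel"
    and "\<And>v. v \<in> elems \<U> Y \<Longrightarrow> apply_map \<U> T v \<in> elems \<U> Y"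
  shows "[T, Y] \<in> rel \<U> self_map_rel"
proof -
  have "sat (rel \<U>) ((!) [T, Y])
     (Atom dom_rel [0, 1] \<^bold>\<longrightarrow>
      Forall 2 (Forall 3 (Atom elem_rel [2, 1] \<^bold>\<longrightarrow> Atom apply_rel [0, 2, 3] \<^bold>\<longrightarrow> Atom elem_rel [3, 1])) \<^bold>\<longrightarrow>
      Atom self_map_rel [0, 1])"
    by (rule transfer_valid) (fastforce simp: ran_def dom_def)
  moreover have "[w, Y] \<in> rel \<U> elem_rel"
    if "[v, Y] \<in> rel \<U> elem_rel" "[T, v, w] \<in> rel \<U> apply_rel" for v w
    using that assms apply_map_rel[OF assms(1), of v w] by (auto simp: elems_def)
  ultimately show ?thesis using assms(1) by simp
qed

lemma star_restrict_rel:
  assumes "[T, Y] \<in> rel \<U> dom_rel"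
  shows "[Y, star_restrict \<U> f Y] \<in> rel \<U> (restrict_rel f)"
proof -
  have "sat (rel \<U>) ((!) [T, Y]) (Atom dom_rel [0, 1] \<^bold>\<longrightarrow> Exi 2 (Atom (restrict_rel f) [1, 2]))"
    by (rule transfer_valid) auto
  then obtain F where F: "[Y, F] \<in> rel \<U> (restrict_rel f)"
    using assms by auto
  have uniq: "F' = F" if "[Y, F'] \<in> rel \<U> (restrict_rel f)" for F'
  proof -
    have "sat (rel \<U>) ((!) [Y, F, F'])
       (Atom (restrict_rel f) [0, 1] \<^bold>\<longrightarrow> Atom (restrict_rel f) [0, 2] \<^bold>\<longrightarrow> Eq 1 2)"
      by (rule transfer_valid) auto
    with that F show ?thesis by simp
  qed
  show ?thesis
    unfolding star_restrict_def using F uniq by (rule theI)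
qed

lemma hyper_average_rel:
  assumes "infinite_hypernatural \<U> N" "[Y, F] \<in> rel \<U> (restrict_rel f)"
    "[T, Y] \<in> rel \<U> dom_rel" "y \<in> elems \<U> Y"
  shows "[N, F, T, y, hyper_average \<U> N F T y] \<in> rel \<U> average_rel"
proof -
  have "sat (rel \<U>) ((!) [N, F, T, y, Y, emb \<U> (Idx 0)])
     (Atom {[Idx i, Idx j] | i j. i < j} [5, 0] \<^bold>\<longrightarrow> Atom (restrict_rel f) [4, 1] \<^bold>\<longrightarrow>
      Atom dom_rel [2, 4] \<^bold>\<longrightarrow> Atom elem_rel [3, 4] \<^bold>\<longrightarrow>
      Exi 6 (Atom average_rel [0, 1, 2, 3, 6]))"
    by (rule transfer_valid) auto
  then obtain r where r: "[N, F, T, y, r] \<in> rel \<U> average_rel"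
    using assms by (auto simp: elems_def infinite_hypernatural_def)
  have uniq: "r' = r" if "[N, F, T, y, r'] \<in> rel \<U> average_rel" for r'
  proof -
    have "sat (rel \<U>) ((!) [N, F, T, y, r, r'])
       (Atom average_rel [0, 1, 2, 3, 4] \<^bold>\<longrightarrow> Atom average_rel [0, 1, 2, 3, 5] \<^bold>\<longrightarrow> Eq 4 5)"
      by (rule transfer_valid) auto
    with that r show ?thesis by simp
  qed
  show ?thesis
    unfolding hyper_average_def using r uniq by (rule theI)
qed

text \<open>
  Only the first \<open>k\<close> points for a standard \<open>k\<close> are compared, so induction on \<open>k\<close> suffices: the
  orbit of \<open>z\<close> is \<open>z\<close>, close to \<open>st z\<close>, followed by the orbit of \<open>T z\<close>, whose standard part is
  \<open>\<tau> (st z)\<close>.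
\<close>

lemma orbit_shadowing:
  fixes \<tau> :: "'a \<Rightarrow> 'a"
  assumes "compact (UNIV :: 'a set)" "\<eta> > 0"
    and T: "[T, Y] \<in> rel \<U> dom_rel"
    and self: "\<And>v. v \<in> elems \<U> Y \<Longrightarrow> apply_map \<U> T v \<in> elems \<U> Y"
    and st: "\<And>v. v \<in> elems \<U> Y \<Longrightarrow> st \<U> (apply_map \<U> T v) = \<tau> (st \<U> v)"
    and "z \<in> elems \<U> Y"
  shows "[T, z] \<in> rel \<U> {[PMap m, Pt p] | m p.
           \<forall>j<k. dist (((\<lambda>q. the (m q)) ^^ j) p) ((\<tau> ^^ j) (st \<U> z)) < \<eta>}"
  using \<open>z \<in> elems \<U> Y\<close>
proof (induction k arbitrary: z)
  case 0
  have "sat (rel \<U>) ((!) [T, Y, z]) (Atom dom_rel [0, 1] \<^bold>\<longrightarrow> Atom elem_rel [2, 1] \<^bold>\<longrightarrow>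
     Atom {[PMap m, Pt p] | m p. True} [0, 2])"
    by (rule transfer_valid) auto
  with T 0 show ?case by (simp add: elems_def)
next
  case (Suc k)
  let ?w = "apply_map \<U> T z" and ?a = "st \<U> z"
  let ?near = "\<lambda>k a. {[PMap m, Pt p] | m p. \<forall>j<k. dist (((\<lambda>q. the (m q)) ^^ j) p) ((\<tau> ^^ j) a) < \<eta>}"
  have step: "\<forall>j<Suc k. dist (((\<lambda>q. the (m q)) ^^ j) p) ((\<tau> ^^ j) ?a) < \<eta>"
    if "dist p ?a < \<eta>" "m p = Some q"
       "\<forall>j<k. dist (((\<lambda>q. the (m q)) ^^ j) q) ((\<tau> ^^ j) (\<tau> ?a)) < \<eta>" for m p q
  proof (intro allI impI)
    fix j assume "j < Suc k"
    then show "dist (((\<lambda>q. the (m q)) ^^ j) p) ((\<tau> ^^ j) ?a) < \<eta>"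
      using that by (cases j) (simp_all add: funpow_swap1[symmetric] del: funpow.simps add: funpow_Suc_right)
  qed
  have "sat (rel \<U>) ((!) [T, z, ?w])
     (Atom {[Pt p] | p. dist p ?a < \<eta>} [1] \<^bold>\<longrightarrow> Atom apply_rel [0, 1, 2] \<^bold>\<longrightarrow>
      Atom (?near k (\<tau> ?a)) [0, 2] \<^bold>\<longrightarrow> Atom (?near (Suc k) ?a) [0, 1])"
    by (rule transfer_valid) (use step in auto)
  moreover have "[T, ?w] \<in> rel \<U> (?near k (\<tau> ?a))"
    using Suc.IH[OF self[OF Suc.prems]] st[OF Suc.prems] by simp
  ultimately show ?case
    using rel_ball_st[OF assms(1) Suc.prems assms(2)] apply_map_rel[OF T Suc.prems] by simp
qed

text \<open>
  Transfer of \<open>average_bound\<close>. The block length \<open>m\<close> and the threshold \<open>k\<close> beyond which the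
  boundary error is small are standard, and an infinite \<open>N\<close> exceeds \<open>k\<close>.
\<close>

lemma hyper_average_bound:
  assumes "m > 0" "\<And>x. \<bar>f x\<bar> \<le> B" "\<delta> > 0"
    and N: "infinite_hypernatural \<U> N"
    and F: "[Y, F] \<in> rel \<U> (restrict_rel f)"
    and T: "[T, Y] \<in> rel \<U> self_map_rel"
    and y: "y \<in> elems \<U> Y"
    and r: "[N, F, T, y, r] \<in> rel \<U> average_rel"
    and block: "\<And>z s. z \<in> elems \<U> Y \<Longrightarrow> [F, T, z, s] \<in> rel \<U> (average_at_rel m) \<Longrightarrow>
                  [s] \<in> rel \<U> {[Num x] | x. \<bar>x - c\<bar> \<le> \<delta>}"
  shows "[r] \<in> rel \<U> {[Num x] | x. \<bar>x - c\<bar> \<le> 2 * \<delta>}"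
proof -
  obtain k :: nat where k: "2 * real m * B / \<delta> \<le> real k"
    using real_arch_simple by blast
  have large: "2 * real m * B \<le> real n * \<delta>" if "k < n" for n
  proof -
    have "2 * real m * B / \<delta> \<le> real n" using k that by linarith
    then show ?thesis using \<open>\<delta> > 0\<close> by (simp add: field_simps)
  qed
  let ?\<phi> = "Atom {[Idx k]} [6] \<^bold>\<longrightarrow> Atom {[Idx i, Idx j] | i j. i < j} [6, 0] \<^bold>\<longrightarrow>
      Atom (restrict_rel f) [4, 1] \<^bold>\<longrightarrow> Atom self_map_rel [2, 4] \<^bold>\<longrightarrow> Atom elem_rel [3, 4] \<^bold>\<longrightarrow>
      Atom average_rel [0, 1, 2, 3, 5] \<^bold>\<longrightarrow>
      Forall 7 (Forall 8 (Atom elem_rel [7, 4] \<^bold>\<longrightarrow> Atom (average_at_rel m) [1, 2, 7, 8] \<^bold>\<longrightarrow>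
        Atom {[Num x] | x. \<bar>x - c\<bar> \<le> \<delta>} [8])) \<^bold>\<longrightarrow>
      Atom {[Num x] | x. \<bar>x - c\<bar> \<le> 2 * \<delta>} [5]"
  have "sat (rel \<U>) ((!) [N, F, T, y, Y, r, emb \<U> (Idx k)]) ?\<phi>"
  proof (rule transfer_valid)
    fix e :: "nat \<Rightarrow> 'a entity"
    have near: "\<bar>average n ((Some \<circ> f) |` dom t) t p - c\<bar> \<le> 2 * \<delta>"
      if "k < n" "ran t \<subseteq> dom t" "p \<in> dom t"
        and block': "\<forall>z. (\<exists>p. z = Pt p \<and> p \<in> dom t) \<longrightarrow>
              (\<forall>s. (\<exists>p. z = Pt p \<and> s = Num (average m ((Some \<circ> f) |` dom t) t p)) \<longrightarrow>
              (\<exists>x. s = Num x \<and> \<bar>x - c\<bar> \<le> \<delta>))" for n t p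
    proof (rule average_bound[OF that(2,3) assms(2) \<open>m > 0\<close>])
      show "\<bar>average m ((Some \<circ> f) |` dom t) t q - c\<bar> \<le> \<delta>" if "q \<in> dom t" for q
        using block'[rule_format, of "Pt q" "Num (average m ((Some \<circ> f) |` dom t) t q)"] that by auto
    qed (use \<open>k < n\<close> large in auto)
    show "sat (\<lambda>R. R) e ?\<phi>"
      by clarsimp (rule near; blast)
  qed
  then show ?thesis
    using assms by (auto simp: rel_emb elems_def infinite_hypernatural_def)
qed

text \<open>
  The block average along \<open>T\<close> is within \<open>\<delta>\<close> of the block average along the \<open>\<tau>\<close>-orbit of
  \<open>st z\<close>, by shadowing and uniform continuity of \<open>f\<close>; the latter average is within \<open>\<delta>\<close> of
  \<open>c\<close>.
\<close>

lemma block_average_near: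
  fixes \<tau> :: "'a \<Rightarrow> 'a" and f :: "'a \<Rightarrow> real"
  assumes compact: "compact (UNIV :: 'a set)" and f: "continuous_on UNIV f" and "\<delta> > 0" "m > 0"
    and T: "[T, Y] \<in> rel \<U> self_map_rel" "[T, Y] \<in> rel \<U> dom_rel"
    and self: "\<And>v. v \<in> elems \<U> Y \<Longrightarrow> apply_map \<U> T v \<in> elems \<U> Y"
    and st: "\<And>v. v \<in> elems \<U> Y \<Longrightarrow> st \<U> (apply_map \<U> T v) = \<tau> (st \<U> v)"
    and m: "\<And>x. \<bar>(\<Sum>j<m. f ((\<tau> ^^ j) x)) / real m - c\<bar> < \<delta>"
    and F: "[Y, F] \<in> rel \<U> (restrict_rel f)"
    and z: "z \<in> elems \<U> Y" and s: "[F, T, z, s] \<in> rel \<U> (average_at_rel m)"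
  shows "[s] \<in> rel \<U> {[Num x] | x. \<bar>x - c\<bar> \<le> 2 * \<delta>}"
proof -
  have "uniformly_continuous_on UNIV f"
    using compact f by (rule compact_uniformly_continuous[rotated])
  then obtain \<eta> where "\<eta> > 0" and \<eta>: "\<And>x y. dist x y < \<eta> \<Longrightarrow> \<bar>f x - f y\<bar> < \<delta>"
    using \<open>\<delta> > 0\<close> unfolding uniformly_continuous_on_def dist_real_def by (metis UNIV_I)
  let ?a = "st \<U> z"
  let ?near = "{[PMap t, Pt p] | t p.
      \<forall>j<m. dist (((\<lambda>q. the (t q)) ^^ j) p) ((\<tau> ^^ j) ?a) < \<eta>}"
  have near: "\<bar>average m ((Some \<circ> f) |` dom t) t p - c\<bar> \<le> 2 * \<delta>"
    if "ran t \<subseteq> dom t" "p \<in> dom t"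
      and d: "\<forall>j<m. dist (((\<lambda>q. the (t q)) ^^ j) p) ((\<tau> ^^ j) ?a) < \<eta>" for t p
  proof -
    let ?b = "\<lambda>j. f (((\<lambda>q. the (t q)) ^^ j) p)" and ?c = "\<lambda>j. f ((\<tau> ^^ j) ?a)"
    have "\<bar>(\<Sum>j<m. ?b j) - (\<Sum>j<m. ?c j)\<bar> \<le> (\<Sum>j<m. \<bar>?b j - ?c j\<bar>)"
      by (simp flip: sum_subtractf)
    also have "\<dots> \<le> (\<Sum>j<m. \<delta>)"
      using d \<eta> by (intro sum_mono less_imp_le) auto
    finally have "\<bar>(\<Sum>j<m. ?b j) / real m - (\<Sum>j<m. ?c j) / real m\<bar> \<le> \<delta>"
      using \<open>m > 0\<close> by (simp flip: diff_divide_distrib add: field_simps)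
    with m[of ?a] show ?thesis
      unfolding average_restrict[OF that(1,2)] by linarith
  qed
  have "sat (rel \<U>) ((!) [Y, F, T, z, s])
     (Atom (restrict_rel f) [0, 1] \<^bold>\<longrightarrow> Atom self_map_rel [2, 0] \<^bold>\<longrightarrow> Atom elem_rel [3, 0] \<^bold>\<longrightarrow>
      Atom ?near [2, 3] \<^bold>\<longrightarrow> Atom (average_at_rel m) [1, 2, 3, 4] \<^bold>\<longrightarrow>
      Atom {[Num x] | x. \<bar>x - c\<bar> \<le> 2 * \<delta>} [4])"
    by (rule transfer_valid, clarsimp) (rule near; blast)
  moreover have "[T, z] \<in> rel \<U> ?near"
    by (rule orbit_shadowing[OF compact \<open>\<eta> > 0\<close> T(2) self st z])
  ultimately show ?thesis
    using F T z s by (simp add: elems_def)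
qed

lemma hyper_average_infinitely_close:
  fixes \<tau> :: "'a \<Rightarrow> 'a" and f :: "'a \<Rightarrow> real"
  assumes compact: "compact (UNIV :: 'a set)" and f: "continuous_on UNIV f"
    and uniform: "\<And>\<epsilon>. \<epsilon> > 0 \<Longrightarrow> \<exists>m>0. \<forall>x. \<bar>(\<Sum>j<m. f ((\<tau> ^^ j) x)) / real m - c\<bar> < \<epsilon>"
    and T: "[T, Y] \<in> rel \<U> dom_rel"
    and self: "\<And>v. v \<in> elems \<U> Y \<Longrightarrow> apply_map \<U> T v \<in> elems \<U> Y"
    and st: "\<And>v. v \<in> elems \<U> Y \<Longrightarrow> st \<U> (apply_map \<U> T v) = \<tau> (st \<U> v)"
    and y: "y \<in> elems \<U> Y" and N: "infinite_hypernatural \<U> N"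
  shows "infinitely_close \<U> (hyper_average \<U> N (star_restrict \<U> f Y) T y) (emb \<U> (Num c))"
proof (rule infinitely_close_NumI)
  fix \<epsilon> :: real assume "\<epsilon> > 0"
  let ?F = "star_restrict \<U> f Y" and ?r = "hyper_average \<U> N (star_restrict \<U> f Y) T y"
  \<comment> \<open>The errors add up to \<open>4 \<delta>\<close>: shadowing and block averages double \<open>\<delta>\<close>, passing from blocks to
      length \<open>N\<close> doubles it again. A further factor 2 makes the final inequality strict.\<close>
  define \<delta> where "\<delta> = \<epsilon> / 8"
  have "\<delta> > 0" using \<open>\<epsilon> > 0\<close> by (simp add: \<delta>_def)
  obtain m where "m > 0" and m: "\<And>x. \<bar>(\<Sum>j<m. f ((\<tau> ^^ j) x)) / real m - c\<bar> < \<delta>"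
    using uniform[OF \<open>\<delta> > 0\<close>] by blast
  have "bounded (range f)"
    using compact_continuous_image[OF f compact] by (rule compact_imp_bounded)
  then obtain B where B: "\<And>x. \<bar>f x\<bar> \<le> B"
    unfolding bounded_iff by auto
  have T': "[T, Y] \<in> rel \<U> self_map_rel"
    using T self by (rule self_map_relI)
  have F: "[Y, ?F] \<in> rel \<U> (restrict_rel f)"
    using T by (rule star_restrict_rel)
  have r: "[N, ?F, T, y, ?r] \<in> rel \<U> average_rel"
    using N F T y by (rule hyper_average_rel)
  have "2 * \<delta> > 0" using \<open>\<delta> > 0\<close> by simp
  from hyper_average_bound[OF \<open>m > 0\<close> B this N F T' y r
      block_average_near[OF compact f \<open>\<delta> > 0\<close> \<open>m > 0\<close> T' T self st m F]]
  have "[?r] \<in> rel \<U> {[Num x] | x. \<bar>x - c\<bar> \<le> 2 * (2 * \<delta>)}" .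
  moreover have "sat (rel \<U>) ((!) [?r]) (Atom {[Num x] | x. \<bar>x - c\<bar> \<le> 2 * (2 * \<delta>)} [0] \<^bold>\<longrightarrow>
      Atom {[Num x] | x. \<bar>x - c\<bar> < \<epsilon>} [0])"
    by (rule transfer_valid) (use \<open>\<epsilon> > 0\<close> in \<open>auto simp: \<delta>_def\<close>)
  ultimately show "[?r] \<in> rel \<U> {[Num x] | x. \<bar>x - c\<bar> < \<epsilon>}" by simp
qed

end

section \<open>Averages of infinite length\<close>

theorem theorem9:
  fixes \<tau> :: "'a::metric_space \<Rightarrow> 'a"
    and \<nu> :: "'a measure"
    and \<U> :: "('a entity, 'w) extension"
    and Y T :: 'w
  assumes "nonstandard_universe \<U>"
    and "compact (UNIV :: 'a set)"
    and "continuous_on UNIV \<tau>"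
    and "uniquely_ergodic \<tau>"
    and "invariant_prob \<tau> \<nu>"
    and "hyperfinite \<U> Y"
    and "st \<U> ` elems \<U> Y = UNIV"
    and "internal_permutation \<U> Y T"
    and "\<forall>y \<in> elems \<U> Y. st \<U> (apply_map \<U> T y) = \<tau> (st \<U> y)"
  shows "\<forall>y \<in> elems \<U> Y. closure (range (\<lambda>n. (\<tau> ^^ n) (st \<U> y))) = UNIV \<longrightarrow>
           (\<forall>N. infinite_hypernatural \<U> N \<longrightarrow>
             (\<forall>f :: 'a \<Rightarrow> real. continuous_on UNIV f \<longrightarrow>
               infinitely_close \<U> (hyper_average \<U> N (star_restrict \<U> f Y) T y)
                 (emb \<U> (Num (integral\<^sup>L \<nu> f)))))"
proof (intro ballI impI allI)
  fix y N and f :: "'a \<Rightarrow> real"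
  assume y: "y \<in> elems \<U> Y" and N: "infinite_hypernatural \<U> N" and f: "continuous_on UNIV f"
  interpret transfer_over_space \<U>
    using assms(1) by unfold_locales (simp add: nonstandard_universe_def)
  have T: "[T, Y] \<in> rel \<U> dom_rel" and bij: "bij_betw (apply_map \<U> T) (elems \<U> Y) (elems \<U> Y)"
    using assms(8) by (simp_all add: internal_permutation_def)
  show "infinitely_close \<U> (hyper_average \<U> N (star_restrict \<U> f Y) T y)
          (emb \<U> (Num (integral\<^sup>L \<nu> f)))"
  proof (rule hyper_average_infinitely_close[OF assms(2) f _ T _ _ y N, where \<tau> = \<tau>])
    show "\<exists>m>0. \<forall>x. \<bar>(\<Sum>j<m. f ((\<tau> ^^ j) x)) / real m - integral\<^sup>L \<nu> f\<bar> < \<epsilon>" if "\<epsilon> > 0" for \<epsilon>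
      by (rule uniform_ergodic_averages[OF assms(2-5) f that])
    show "apply_map \<U> T v \<in> elems \<U> Y" if "v \<in> elems \<U> Y" for v
      using bij that by (auto simp: bij_betw_def)
    show "st \<U> (apply_map \<U> T v) = \<tau> (st \<U> v)" if "v \<in> elems \<U> Y" for v
      using assms(9) that by blast
  qed
qed

end
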